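(* The series $\sum_{k=0}^{\infty}(-1)^k c_k$ converges (as the limit of its partial sums), and $$\sum_{k=0}^{\infty}(-1)^k c_k=\sum_{k=1}^{\infty}\frac{1}{2^k}\,\frac{1}{\zeta(2k)}.$$
   Context: Let $\zeta$ denote the Riemann zeta function. For integers $k\ge 0$ define the Báez-Duarte sequence $$c_k=\sum_{j=0}^{k}(-1)^j\binom{k}{j}\frac{1}{\zeta(2j+2)}.$$ *)

theory Defs
  imports "HOL-Analysis.Analysis"
begin

definition dirichlet_zeta :: "complex \<Rightarrow> complex" where
  "dirichlet_zeta s = (\<Sum>n. of_nat (Suc n) powr (- s))"

text \<open>
  On \<open>Re s > 1\<close> the zeta function is its Dirichlet series. Elsewhere it is the value of the
  holomorphic continuation to the complex plane without \<open>1\<close>, which is unique by the identity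
  theorem. At the pole \<open>s = 1\<close> the value is unspecified.
\<close>
definition riemann_zeta :: "complex \<Rightarrow> complex" where
  "riemann_zeta s =
     (if Re s > 1 then dirichlet_zeta s
      else (THE w. \<exists>f. f holomorphic_on (- {1}) \<and>
                       (\<forall>z. Re z > 1 \<longrightarrow> f z = dirichlet_zeta z) \<and> w = f s))"

text \<open>The series converges on the half-plane, so \<open>suminf\<close> is meaningful there.\<close>
lemma dirichlet_zeta_sums:
  assumes "Re s > 1"
  shows "(\<lambda>n. of_nat (Suc n) powr (- s)) sums dirichlet_zeta s"
proof -
  have "summable (\<lambda>n. real n powr (- Re s))"
    using assms by (simp add: summable_real_powr_iff)
  hence *: "summable (\<lambda>n. real (Suc n) powr (- Re s))"
    by (rule iffD2 [OF summable_Suc_iff [of "\<lambda>n. real n powr (- Re s)"]])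
  have norm_eq: "norm (complex_of_nat (Suc n) powr (- s)) = real (Suc n) powr (- Re s)" for n
  proof -
    have "complex_of_nat (Suc n) \<in> \<real>" "0 \<le> Re (complex_of_nat (Suc n))"
      by simp_all
    from norm_powr_real_powr [OF this, of "- s"] show ?thesis
      by (simp only: complex_Re_of_nat uminus_complex.sel)
  qed
  have "summable (\<lambda>n. norm (complex_of_nat (Suc n) powr (- s)))"
    unfolding norm_eq by (rule *)
  hence "summable (\<lambda>n. complex_of_nat (Suc n) powr (- s))"
    by (rule summable_norm_cancel)
  thus ?thesis
    unfolding dirichlet_zeta_def by (rule summable_sums)
qed

definition baez_duarte :: "nat \<Rightarrow> complex" where
  "baez_duarte k =
     (\<Sum>j=0..k. (-1) ^ j * of_nat (k choose j) * (1 / riemann_zeta (2 * of_nat j + 2)))"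

end

theory Submission
  imports Defs "HOL-Computational_Algebra.Squarefree"
begin

text \<open>
  Let \<open>\<mu>\<close> be the Moebius function and \<open>q\<^sub>n = 1/n\<^sup>2\<close>. Since
  \<open>1/\<zeta>(2j+2) = \<Sum>\<^sub>n \<mu>(n) q\<^sub>n q\<^sub>n\<^sup>j\<close> converges absolutely, the binomial theorem turns
  the alternating binomial sum into \<open>c\<^sub>k = \<Sum>\<^sub>n \<mu>(n) q\<^sub>n (1 - q\<^sub>n)\<^sup>k\<close>. Both series of the
  theorem are therefore superpositions, over \<open>n\<close>, of geometric series in \<open>k\<close>: one has ratio
  \<open>q\<^sub>n - 1\<close>, the other has ratio \<open>q\<^sub>n/2\<close>, and for each \<open>n\<close> both have the same sum
  \<open>b\<^sub>n = \<mu>(n) q\<^sub>n / (2 - q\<^sub>n)\<close>. So each side equals \<open>\<Sum>\<^sub>n b\<^sub>n\<close>, provided that the sum over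
  \<open>k\<close> may be taken inside.

  The ratios \<open>q\<^sub>n - 1\<close> tend to \<open>-1\<close>, and the first double series does not converge absolutely:
  \<open>\<Sum>\<^sub>k \<bar>\<mu>(n)\<bar> q\<^sub>n (1 - q\<^sub>n)\<^sup>k\<close> is \<open>\<bar>\<mu>(n)\<bar>\<close>, which is not summable over \<open>n\<close>.
  The interchange is instead justified on partial sums: the first \<open>N\<close> terms add up to
  \<open>\<Sum>\<^sub>n b\<^sub>n - \<Sum>\<^sub>n b\<^sub>n r\<^sub>n\<^sup>N\<close>, where \<open>r\<^sub>n\<close> is the ratio, and the second sum tends to \<open>0\<close>
  by dominated convergence because \<open>\<bar>r\<^sub>n\<bar> < 1\<close> and \<open>b\<close> is absolutely summable. This is
  \<open>sums_superposed_geometric\<close>, which serves both sides; the Moebius series for the reciprocal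
  zeta values is \<open>inverse_riemann_zeta_even\<close>.
\<close>

section \<open>The Moebius function\<close>

definition moebius_mu :: "nat \<Rightarrow> real" where
  "moebius_mu n = (if squarefree n then (-1) ^ card (prime_factors n) else 0)"

lemma norm_moebius_mu_le: "norm (moebius_mu n) \<le> 1"
  by (simp add: moebius_mu_def)

lemma moebius_mu_mult_prime:
  assumes "prime p" "squarefree d" "\<not> p dvd d"
  shows   "moebius_mu (p * d) = - moebius_mu d"
proof -
  have cop: "coprime p d"
    using assms by (simp add: prime_imp_coprime)
  have "d \<noteq> 0" "p \<noteq> 0"
    using assms by (auto intro: ccontr)
  then have "prime_factors (p * d) = insert p (prime_factors d)"
    using assms by (simp add: prime_factors_product prime_prime_factors)
  moreover have "p \<notin> prime_factors d"
    using assms by auto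
  moreover have "squarefree (p * d)"
    using cop squarefree_prime [OF assms(1)] assms(2) by (rule squarefree_mult_coprime)
  ultimately show ?thesis
    using assms by (simp add: moebius_mu_def)
qed

text \<open>
  For a prime \<open>p\<close> dividing \<open>n\<close>, multiplication by \<open>p\<close> maps the squarefree divisors of \<open>n\<close>
  prime to \<open>p\<close> bijectively onto those divisible by \<open>p\<close> and flips the sign of \<open>\<mu>\<close>, so that
  the sum cancels in pairs.
\<close>
lemma sum_moebius_mu_divisors:
  assumes "n > 0"
  shows   "(\<Sum>d | d dvd n. moebius_mu d) = (if n = 1 then 1 else 0)"
proof (cases "n = 1")
  case True
  then show ?thesis by (simp add: moebius_mu_def)
next
  case False
  then obtain p where p: "prime p" "p dvd n"
    using prime_factor_nat by blast
  have "p > 0" using p by (simp add: prime_gt_0_nat)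
  define D where "D = {d. d dvd n \<and> squarefree d}"
  define A where "A = {d \<in> D. \<not> p dvd d}"
  define B where "B = {d \<in> D. p dvd d}"
  have fin: "finite {d. d dvd n}" using assms by simp
  then have "finite D" by (rule finite_subset [rotated]) (auto simp: D_def)
  have "(\<Sum>d | d dvd n. moebius_mu d) = (\<Sum>d\<in>D. moebius_mu d)"
    by (rule sum.mono_neutral_right) (use fin in \<open>auto simp: D_def moebius_mu_def\<close>)
  also have "D = A \<union> B" by (auto simp: A_def B_def)
  also have "(\<Sum>d\<in>A \<union> B. moebius_mu d) = (\<Sum>d\<in>A. moebius_mu d) + (\<Sum>d\<in>B. moebius_mu d)"
    by (rule sum.union_disjoint) (use \<open>finite D\<close> in \<open>auto simp: A_def B_def\<close>)
  also have "(\<Sum>d\<in>B. moebius_mu d) = (\<Sum>d\<in>A. - moebius_mu d)"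
  proof (rule sum.reindex_bij_witness [of _ "\<lambda>d. p * d" "\<lambda>d. d div p"])
    fix d assume d: "d \<in> B"
    then obtain e where e: "d = p * e" by (auto simp: B_def)
    have sq: "squarefree (p * e)" and dvd: "p * e dvd n"
      using d by (auto simp: B_def D_def e)
    have "\<not> p dvd e"
    proof
      assume "p dvd e"
      then have "p ^ 2 dvd p * e" by (simp add: power2_eq_square)
      with sq have "is_unit p" by (rule squarefreeD)
      with p show False by simp
    qed
    then show "d div p \<in> A"
      using \<open>p > 0\<close> squarefree_multD[OF sq] dvd by (auto simp: A_def D_def e dest: dvd_mult_right)
    show "p * (d div p) = d"
      using \<open>p > 0\<close> by (simp add: e)
    show "- moebius_mu (d div p) = moebius_mu d"
      using moebius_mu_mult_prime[OF p(1) squarefree_multD(2)[OF sq] \<open>\<not> p dvd e\<close>] \<open>p > 0\<close>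
      by (simp add: e)
  next
    fix d assume d: "d \<in> A"
    then have d': "squarefree d" "d dvd n" "\<not> p dvd d" by (auto simp: A_def D_def)
    have cop: "coprime p d"
      using d' p by (simp add: prime_imp_coprime)
    have "squarefree (p * d)"
      using cop squarefree_prime [OF p(1)] d'(1) by (rule squarefree_mult_coprime)
    then show "p * d \<in> B"
      using cop p d' by (auto simp: B_def D_def intro: divides_mult)
    show "p * d div p = d"
      using \<open>p > 0\<close> by simp
  qed
  finally show ?thesis using False by (simp add: sum_negf)
qed

section \<open>Superpositions of geometric series\<close>

lemma superposed_powers_tendsto_0:
  fixes b r :: "nat \<Rightarrow> real"
  assumes "summable (\<lambda>n. \<bar>b n\<bar>)" "\<And>n. \<bar>r n\<bar> < 1"
  shows   "(\<lambda>k. \<Sum>n. b n * r n ^ k) \<longlonglongrightarrow> 0"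
proof -
  have "(\<lambda>k. \<Sum>n. b n * r n ^ k) \<longlonglongrightarrow> (\<Sum>n. 0)"
  proof (rule tannerys_theorem [THEN conjunct2, THEN conjunct2])
    show "(\<lambda>k. b n * r n ^ k) \<longlonglongrightarrow> 0" for n
      using assms(2) by (intro tendsto_mult_right_zero LIMSEQ_power_zero) auto
    show "\<forall>\<^sub>F (n, k) in sequentially \<times>\<^sub>F sequentially. norm (b n * r n ^ k) \<le> \<bar>b n\<bar>"
      using assms(2) by (intro always_eventually)
        (auto simp: abs_mult power_abs less_imp_le intro!: mult_left_le power_le_one)
  qed (use assms in auto)
  then show ?thesis by simp
qed

text \<open>
  For fixed \<open>n\<close>, the term \<open>b n * (1 - r n) * r n ^ k\<close> is the \<open>k\<close>-th term of the geometric
  series with ratio \<open>r n\<close> and sum \<open>b n\<close>. Telescoping in \<open>k\<close> before any limit is taken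
  allows the ratios to come arbitrarily close to \<open>\<plusminus>1\<close>.
\<close>
lemma sums_superposed_geometric:
  fixes b r :: "nat \<Rightarrow> real"
  assumes b: "summable (\<lambda>n. \<bar>b n\<bar>)" and r: "\<And>n. \<bar>r n\<bar> < 1"
  shows   "(\<lambda>k. \<Sum>n. b n * (1 - r n) * r n ^ k) sums (\<Sum>n. b n)"
proof -
  have summ: "summable (\<lambda>n. b n * r n ^ k)" for k
    by (rule summable_comparison_test' [OF b])
       (auto simp: abs_mult power_abs r less_imp_le intro!: mult_left_le power_le_one)
  have step: "(\<Sum>n. b n * (1 - r n) * r n ^ k) = (\<Sum>n. b n * r n ^ k) - (\<Sum>n. b n * r n ^ Suc k)" for k
    by (subst suminf_diff [OF summ summ]) (simp add: algebra_simps)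
  have "(\<lambda>k. (\<Sum>n. b n * r n ^ k) - (\<Sum>n. b n * r n ^ Suc k)) sums ((\<Sum>n. b n * r n ^ 0) - 0)"
    by (rule telescope_sums' [OF superposed_powers_tendsto_0 [OF b r]])
  then show ?thesis by (simp add: step)
qed

section \<open>The Dirichlet series of the reciprocal zeta function\<close>

lemma has_sum_positive_nat:
  fixes f :: "nat \<Rightarrow> real"
  assumes "summable (\<lambda>n. \<bar>f (Suc n)\<bar>)"
  shows   "(f has_sum (\<Sum>n. f (Suc n))) {0<..}"
proof -
  have "((\<lambda>n. f (Suc n)) has_sum (\<Sum>n. f (Suc n))) UNIV"
    using assms by (intro norm_summable_imp_has_sum summable_sums)
      (auto intro: summable_rabs_cancel)
  then show ?thesis
    by (subst has_sum_reindex_bij_witness [of _ Suc "\<lambda>n. n - 1" UNIV "\<lambda>n. f (Suc n)"]) auto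
qed

lemma summable_inverse_Suc_power:
  assumes "s \<ge> 2"
  shows   "summable (\<lambda>n. 1 / real (Suc n) ^ s)"
  using inverse_power_summable [OF assms, where ?'a = real]
  by (subst summable_Suc_iff) (simp add: inverse_eq_divide)

lemma summable_moebius_mu:
  assumes "s \<ge> 2"
  shows   "summable (\<lambda>n. \<bar>moebius_mu (Suc n) / real (Suc n) ^ s\<bar>)"
  by (rule summable_comparison_test' [OF summable_inverse_Suc_power [OF assms]])
     (use norm_moebius_mu_le in \<open>auto simp: divide_right_mono\<close>)

text \<open>
  The product is an absolutely convergent double series over \<open>(d, m)\<close>. Grouping its terms by
  \<open>n = d * m\<close> gives the coefficient \<open>\<Sum>d | d dvd n. \<mu>(d)\<close> at \<open>1 / n ^ s\<close>, which vanishes unless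
  \<open>n = 1\<close>.
\<close>
lemma moebius_mu_series_times_zeta_series:
  assumes s: "s \<ge> 2"
  shows   "(\<Sum>n. moebius_mu (Suc n) / real (Suc n) ^ s) * (\<Sum>n. 1 / real (Suc n) ^ s) = 1"
    (is "?M * ?Z = 1")
proof -
  define A where "A = {0::nat<..}"
  define f where "f = (\<lambda>(d, m). moebius_mu d / real d ^ s * (1 / real m ^ s))"
  have M: "((\<lambda>d. moebius_mu d / real d ^ s) has_sum ?M) A"
    unfolding A_def by (rule has_sum_positive_nat [OF summable_moebius_mu [OF s]])
  have Z: "((\<lambda>m. 1 / real m ^ s) has_sum ?Z) A"
    unfolding A_def by (rule has_sum_positive_nat) (use summable_inverse_Suc_power [OF s] in simp)
  have Mabs: "(\<lambda>d. \<bar>moebius_mu d / real d ^ s\<bar>) summable_on A"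
    using has_sum_positive_nat [of "\<lambda>d. \<bar>moebius_mu d / real d ^ s\<bar>"] summable_moebius_mu [OF s]
    unfolding A_def summable_on_def by auto
  have row: "((\<lambda>m. f (d, m)) has_sum (moebius_mu d / real d ^ s * ?Z)) A" for d
    unfolding f_def prod.case by (rule has_sum_cmult_right [OF Z])
  have row_abs: "((\<lambda>m. norm (f (d, m))) has_sum (\<bar>moebius_mu d / real d ^ s\<bar> * ?Z)) A" for d
    using has_sum_cmult_right [OF Z, of "\<bar>moebius_mu d / real d ^ s\<bar>"]
    by (simp add: f_def abs_mult)
  have "(\<lambda>x. norm (f x)) summable_on (A \<times> A)"
  proof (rule Infinite_Sum.abs_summable_on_Sigma_iff [THEN iffD2], intro conjI ballI)
    show "(\<lambda>m. norm (f (d, m))) summable_on A" for d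
      using row_abs by (rule has_sum_imp_summable)
    show "(\<lambda>d. norm (\<Sum>\<^sub>\<infinity>m\<in>A. norm (f (d, m)))) summable_on A"
      unfolding infsumI [OF row_abs]
      using summable_on_cmult_left [OF Mabs, of "\<bar>?Z\<bar>"] by (simp add: abs_mult)
  qed
  then have "f summable_on (A \<times> A)"
    by (rule Infinite_Sum.abs_summable_summable)
  then have "(f has_sum (?M * ?Z)) (A \<times> A)"
    by (rule has_sum_SigmaI [OF row has_sum_cmult_left [OF M]])
  also have "?this \<longleftrightarrow>
      ((\<lambda>(n, d). moebius_mu d / real n ^ s) has_sum (?M * ?Z)) (Sigma A (\<lambda>n. {d. d dvd n}))"
    by (rule has_sum_reindex_bij_witness [of _ "\<lambda>(n, d). (d, n div d)" "\<lambda>(d, m). (d * m, d)"])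
       (auto simp: A_def f_def power_mult_distrib dvd_def)
  finally have "((\<lambda>(n, d). moebius_mu d / real n ^ s) has_sum (?M * ?Z)) (Sigma A (\<lambda>n. {d. d dvd n}))" .
  then have "((\<lambda>n. if n = 1 then 1 else 0) has_sum (?M * ?Z)) A"
  proof (rule has_sum_SigmaD)
    fix n assume "n \<in> A"
    then have "n > 0" by (simp add: A_def)
    have "(\<Sum>d | d dvd n. moebius_mu d / real n ^ s) = (if n = 1 then 1 else 0)"
      using sum_moebius_mu_divisors [OF \<open>n > 0\<close>] by (simp flip: sum_divide_distrib)
    then show "((\<lambda>d. case (n, d) of (n, d) \<Rightarrow> moebius_mu d / real n ^ s) has_sum
        (if n = 1 then 1 else 0)) {d. d dvd n}"
      using \<open>n > 0\<close> by (intro has_sum_finiteI) auto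
  qed
  moreover have "((\<lambda>n. if n = 1 then 1 else 0 :: real) has_sum 1) A"
    by (rule has_sum_finite_neutralI [of "{1}"]) (auto simp: A_def)
  ultimately show ?thesis
    by (rule has_sum_unique)
qed

lemma inverse_riemann_zeta_even:
  "1 / riemann_zeta (2 * of_nat j + 2) =
     of_real (\<Sum>n. moebius_mu (Suc n) / real (Suc n) ^ (2 * j + 2))" (is "_ = of_real ?M")
proof -
  let ?Z = "\<Sum>n. 1 / real (Suc n) ^ (2 * j + 2)"
  have "of_nat (Suc n) powr - (2 * of_nat j + 2) = complex_of_real (1 / real (Suc n) ^ (2 * j + 2))" for n
  proof -
    have exponent: "2 * of_nat j + 2 = (of_nat (2 * j + 2) :: complex)"
      by simp
    have "of_nat (Suc n) powr - (2 * of_nat j + 2 :: complex) =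
        inverse (of_nat (Suc n) powr of_nat (2 * j + 2))"
      unfolding exponent by (rule powr_minus)
    also have "\<dots> = inverse (of_nat (Suc n) ^ (2 * j + 2))"
      by (subst powr_nat') (simp_all del: of_nat_Suc)
    finally show ?thesis
      by (simp only: of_real_divide of_real_power of_real_of_nat_eq of_real_1 inverse_eq_divide)
  qed
  moreover have "Re (2 * of_nat j + 2) > 1"
    by simp
  ultimately have "riemann_zeta (2 * of_nat j + 2) = (\<Sum>n. of_real (1 / real (Suc n) ^ (2 * j + 2)))"
    by (simp only: riemann_zeta_def dirichlet_zeta_def if_True)
  also have "\<dots> = of_real ?Z"
    by (rule suminf_of_real [symmetric], rule summable_inverse_Suc_power) simp
  finally have "riemann_zeta (2 * of_nat j + 2) = of_real ?Z" .
  moreover have "?M * ?Z = 1"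
    by (rule moebius_mu_series_times_zeta_series) simp
  moreover from this have "?M = 1 / ?Z"
    by (intro nonzero_eq_divide_eq [THEN iffD2] notI) (simp_all del: of_nat_Suc power_Suc)
  ultimately show ?thesis
    by (simp only: of_real_divide of_real_1)
qed

section \<open>The Baez-Duarte sequence\<close>

text \<open>
  The Moebius series of the finitely many reciprocal zeta values are added termwise; the
  binomial theorem then sums the coefficient of each \<open>\<mu>(n)\<close>.
\<close>
lemma baez_duarte_eq:
  "baez_duarte k = of_real (\<Sum>n. moebius_mu (Suc n) / real (Suc n) ^ 2 * (1 - 1 / real (Suc n) ^ 2) ^ k)"
proof -
  define a where "a = (\<lambda>j n. moebius_mu (Suc n) / real (Suc n) ^ (2 * j + 2))"
  have summ: "summable (a j)" for j
    using summable_rabs_cancel [OF summable_moebius_mu [of "2 * j + 2"]] by (simp add: a_def)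
  have "(\<Sum>j=0..k. (-1) ^ j * real (k choose j) * a j n) =
      moebius_mu (Suc n) / real (Suc n) ^ 2 * (1 - 1 / real (Suc n) ^ 2) ^ k" for n
  proof -
    have regroup: "m / x * (s * b / y) = s * b * (m / (y * x))" for m x s b y :: real
      by (simp add: mult_ac)
    have "(1 - 1 / real (Suc n) ^ 2) ^ k = (- 1 / real (Suc n) ^ 2 + 1) ^ k"
      by simp
    also have "\<dots> = (\<Sum>j\<le>k. real (k choose j) * (- 1 / real (Suc n) ^ 2) ^ j)"
      by (subst binomial_ring) simp
    also have "\<dots> = (\<Sum>j=0..k. (-1) ^ j * real (k choose j) / real (Suc n) ^ (2 * j))"
    proof (rule sum.cong)
      fix j
      have "(- 1 / real (Suc n) ^ 2) ^ j = (-1) ^ j / real (Suc n) ^ (2 * j)"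
        by (simp only: power_divide power_mult)
      then show "real (k choose j) * (- 1 / real (Suc n) ^ 2) ^ j =
          (-1) ^ j * real (k choose j) / real (Suc n) ^ (2 * j)"
        by simp
    qed auto
    finally have "moebius_mu (Suc n) / real (Suc n) ^ 2 * (1 - 1 / real (Suc n) ^ 2) ^ k =
        (\<Sum>j=0..k. moebius_mu (Suc n) / real (Suc n) ^ 2 *
          ((-1) ^ j * real (k choose j) / real (Suc n) ^ (2 * j)))"
      by (simp only: sum_distrib_left)
    also have "\<dots> = (\<Sum>j=0..k. (-1) ^ j * real (k choose j) * a j n)"
      unfolding a_def power_add regroup ..
    finally show ?thesis ..
  qed
  moreover have "(\<Sum>n. \<Sum>j=0..k. (-1) ^ j * real (k choose j) * a j n) =
      (\<Sum>j=0..k. (-1) ^ j * real (k choose j) * (\<Sum>n. a j n))"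
    by (subst suminf_sum) (auto simp: suminf_mult summ intro: summable_mult)
  ultimately show ?thesis
    unfolding baez_duarte_def inverse_riemann_zeta_even by (simp add: a_def)
qed

theorem mainTheorem3:
  shows "summable (\<lambda>k. (-1) ^ k * baez_duarte k) \<and>
         summable (\<lambda>k. 1 / 2 ^ Suc k * (1 / riemann_zeta (2 * of_nat (Suc k)))) \<and>
         (\<Sum>k. (-1) ^ k * baez_duarte k) =
           (\<Sum>k. 1 / 2 ^ Suc k * (1 / riemann_zeta (2 * of_nat (Suc k))))"
proof -
  define q where "q n = 1 / real (Suc n) ^ 2" for n
  define b where "b = (\<lambda>n. moebius_mu (Suc n) * (q n / (2 - q n)))"
  have q: "0 < q n" "q n \<le> 1" for n
    by (auto simp: q_def divide_le_eq simp del: of_nat_Suc)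
  \<comment> \<open>Since \<open>2 - q n \<ge> 1\<close>, \<open>\<bar>b n\<bar>\<close> is at most \<open>q n\<close>.\<close>
  have b_sum: "summable (\<lambda>n. \<bar>b n\<bar>)"
  proof (rule summable_comparison_test' [OF summable_inverse_Suc_power [of 2]])
    fix n
    have "\<bar>moebius_mu (Suc n)\<bar> * (q n / (2 - q n)) \<le> 1 * (q n / 1)"
      using norm_moebius_mu_le [of "Suc n"] q [of n] by (intro mult_mono frac_le) auto
    then show "norm \<bar>b n\<bar> \<le> 1 / real (Suc n) ^ 2"
      using q [of n] by (simp add: b_def abs_mult q_def [symmetric] del: of_nat_Suc)
  qed simp

  \<comment> \<open>Ratio \<open>q n - 1\<close>: the factor \<open>1 - (q n - 1)\<close> cancels the denominator of \<open>b n\<close>.\<close>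
  have "(\<lambda>k. \<Sum>n. b n * (1 - (q n - 1)) * (q n - 1) ^ k) sums (\<Sum>n. b n)"
  proof (rule sums_superposed_geometric [OF b_sum])
    show "\<bar>q n - 1\<bar> < 1" for n
      using q [of n] by linarith
  qed
  from sums_of_real [OF this, where ?'a = complex]
  have lhs: "(\<lambda>k. of_real (\<Sum>n. b n * (1 - (q n - 1)) * (q n - 1) ^ k)) sums
      complex_of_real (\<Sum>n. b n)" .
  have lhs_term: "of_real (\<Sum>n. b n * (1 - (q n - 1)) * (q n - 1) ^ k) = (-1) ^ k * baez_duarte k" for k
  proof -
    have "b n * (1 - (q n - 1)) * (q n - 1) ^ k = (-1) ^ k * (moebius_mu (Suc n) * q n * (1 - q n) ^ k)" for n
      using q [of n] power_mult_distrib [of "-1" "1 - q n" k] by (simp add: b_def)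
    moreover have "summable (\<lambda>n. moebius_mu (Suc n) * q n * (1 - q n) ^ k)"
    proof (rule summable_comparison_test' [OF summable_inverse_Suc_power [of 2]])
      fix n
      have "\<bar>moebius_mu (Suc n)\<bar> * q n * (1 - q n) ^ k \<le> 1 * q n * 1"
        using norm_moebius_mu_le [of "Suc n"] q [of n] by (intro mult_mono power_le_one) auto
      then show "norm (moebius_mu (Suc n) * q n * (1 - q n) ^ k) \<le> 1 / real (Suc n) ^ 2"
        using q [of n] by (simp add: abs_mult power_abs q_def [symmetric] del: of_nat_Suc)
    qed simp
    ultimately have "(\<Sum>n. b n * (1 - (q n - 1)) * (q n - 1) ^ k) =
        (-1) ^ k * (\<Sum>n. moebius_mu (Suc n) * q n * (1 - q n) ^ k)"
      by (simp only: suminf_mult)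
    then show ?thesis
      by (simp add: baez_duarte_eq q_def)
  qed

  \<comment> \<open>Ratio \<open>q n / 2\<close>: here \<open>1 - q n / 2\<close> is half that denominator, and the missing factor
      \<open>1 / 2\<close> raises the power of \<open>2\<close> to \<open>Suc k\<close>.\<close>
  have "(\<lambda>k. \<Sum>n. b n * (1 - q n / 2) * (q n / 2) ^ k) sums (\<Sum>n. b n)"
  proof (rule sums_superposed_geometric [OF b_sum])
    show "\<bar>q n / 2\<bar> < 1" for n
      using q [of n] by linarith
  qed
  from sums_of_real [OF this, where ?'a = complex]
  have rhs: "(\<lambda>k. of_real (\<Sum>n. b n * (1 - q n / 2) * (q n / 2) ^ k)) sums
      complex_of_real (\<Sum>n. b n)" .
  have rhs_term: "of_real (\<Sum>n. b n * (1 - q n / 2) * (q n / 2) ^ k) =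
      1 / 2 ^ Suc k * (1 / riemann_zeta (2 * of_nat (Suc k)))" for k
  proof -
    have "b n * (1 - q n / 2) * (q n / 2) ^ k =
        1 / 2 ^ Suc k * (moebius_mu (Suc n) / real (Suc n) ^ (2 * k + 2))" for n
    proof -
      have "b n * (1 - q n / 2) = moebius_mu (Suc n) * (q n / 2)"
        using q [of n] by (simp add: b_def field_simps)
      moreover have "(q n / 2) ^ k = 1 / (real (Suc n) ^ (2 * k) * 2 ^ k)"
        by (simp only: q_def power_divide power_one power_mult power_mult_distrib divide_divide_eq_left)
      ultimately show ?thesis
        by (simp add: q_def power2_eq_square del: of_nat_Suc)
    qed
    moreover have "summable (\<lambda>n. moebius_mu (Suc n) / real (Suc n) ^ (2 * k + 2))"
      by (rule summable_rabs_cancel [OF summable_moebius_mu]) simp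
    ultimately have "(\<Sum>n. b n * (1 - q n / 2) * (q n / 2) ^ k) =
        1 / 2 ^ Suc k * (\<Sum>n. moebius_mu (Suc n) / real (Suc n) ^ (2 * k + 2))"
      by (simp only: suminf_mult)
    moreover have "2 * of_nat (Suc k) = (2 * of_nat k + 2 :: complex)"
      by simp
    ultimately show ?thesis
      by (simp only: inverse_riemann_zeta_even) simp
  qed
  show ?thesis
    using lhs [unfolded lhs_term] rhs [unfolded rhs_term] by (simp only: sums_iff)
qed

end
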